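(* Let $f:\mathbb{R}^n\to\mathbb{R}$ be continuously differentiable, $\varphi:\mathbb{R}^n\to\mathbb{R}$ convex, and $\psi:=f+\varphi$. Let $\{x^k\}$ be any (infinite) sequence generated by the regularized proximal quasi-Newton method described in the context, none of whose iterates is a stationary point of $\psi$. Assume that the matrices $B_k$ used in the method form a bounded sequence of symmetric matrices and that $\psi$ is bounded from below. Then $$\liminf_{k\to\infty}\|r(x^k)\|=0 .$$
   Context: $\|\cdot\|$ is the Euclidean norm. For a symmetric positive definite $H\in\mathbb{R}^{n\times n}$, $\operatorname{prox}_\varphi^H(x):=\arg\min_y\{\varphi(y)+\tfrac12(y-x)^TH(y-x)\}$, and $r_H(x):=\arg\min_d\{\nabla f(x)^Td+\tfrac12d^THd+\varphi(x+d)\}=\operatorname{prox}_\varphi^H(x-H^{-1}\nabla f(x))-x$; moreover $r(x):=r_I(x)$ with $I$ the identity matrix. A point $x^*$ is a stationary point of $\psi$ if $0\in\nabla f(x^* )+\partial\varphi(x^* )$, where $\partial\varphi$ is the convex subdifferential (equivalently $r(x^* )=0$). Regularized proximal quasi-Newton method. Choose $x^0\in\mathbb{R}^n$ and parameters $\mu_0>0$, $p_{\min}\in(0,\tfrac12)$, $c_1\in(0,\tfrac12)$, $c_2\in(c_1,1)$, $\sigma_1\in(0,1)$, $\sigma_2>1$. For $k=0,1,2,\dots$: choose $B_k\in\mathbb{R}^{n\times n}$, put $q_k(d):=f(x^k)+\nabla f(x^k)^Td+\tfrac12d^TB_kd+\varphi(x^k+d)$ and $\hat q_k(d):=q_k(d)+\tfrac12\mu_k\|d\|^2$,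 and let $d^k$ be a solution (global minimizer) of $\min_d\hat q_k(d)$, if one exists. Define $\operatorname{pred}_k:=\psi(x^k)-q_k(d^k)$ and $\operatorname{ared}_k:=\psi(x^k)-\psi(x^k+d^k)$. (i) If $\min_d\hat q_k(d)$ has no solution, or if $\operatorname{pred}_k\le p_{\min}\|d^k\|\,\|r(x^k)\|$, set $x^{k+1}:=x^k$ and $\mu_{k+1}:=\sigma_2\mu_k$. (ii) Otherwise set $\rho_k:=\operatorname{ared}_k/\operatorname{pred}_k$; set $x^{k+1}:=x^k$ if $\rho_k\le c_1$ and $x^{k+1}:=x^k+d^k$ otherwise; set $\mu_{k+1}:=\sigma_2\mu_k$ if $\rho_k\le c_1$, $\mu_{k+1}:=\mu_k$ if $c_1<\rho_k\le c_2$, and $\mu_{k+1}:=\sigma_1\mu_k$ if $\rho_k>c_2$. The method is run without stopping, producing an infinite sequence. *)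

theory Defs
  imports "HOL-Analysis.Analysis"
begin

text \<open>
  Throughout, \<open>g\<close> stands for the gradient of \<open>f\<close>; theorems tie the two together by
  \<open>GDERIV f x :> g x\<close> for all \<open>x\<close>.
\<close>

definition subdifferential :: "('a::real_inner \<Rightarrow> real) \<Rightarrow> 'a \<Rightarrow> 'a set" where
  "subdifferential \<phi> x = {v. \<forall>y. \<phi> x + v \<bullet> (y - x) \<le> \<phi> y}"

definition stationary_point :: "('a::real_inner \<Rightarrow> 'a) \<Rightarrow> ('a \<Rightarrow> real) \<Rightarrow> 'a \<Rightarrow> bool" where
  "stationary_point g \<phi> x \<longleftrightarrow> 0 \<in> {g x + v |v. v \<in> subdifferential \<phi> x}"

text \<open>
  \<open>arg_min_on\<close> picks some global minimizer. For convex \<open>\<phi>\<close> and symmetric positive definite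
  \<open>H\<close> the minimizer below exists and is unique; only such \<open>H\<close> are meant.
\<close>

definition residual_wrt ::
  "real^'n^'n \<Rightarrow> (real^'n \<Rightarrow> real^'n) \<Rightarrow> (real^'n \<Rightarrow> real) \<Rightarrow> real^'n \<Rightarrow> real^'n" where
  "residual_wrt H g \<phi> x =
     arg_min_on (\<lambda>d. g x \<bullet> d + 1/2 * (d \<bullet> (H *v d)) + \<phi> (x + d)) UNIV"

definition residual ::
  "(real^'n \<Rightarrow> real^'n) \<Rightarrow> (real^'n \<Rightarrow> real) \<Rightarrow> real^'n \<Rightarrow> real^'n" where
  "residual g \<phi> x = residual_wrt (mat 1) g \<phi> x"

definition quad_model ::
  "(real^'n \<Rightarrow> real) \<Rightarrow> (real^'n \<Rightarrow> real^'n) \<Rightarrow> (real^'n \<Rightarrow> real) \<Rightarrow> real^'n^'n \<Rightarrow> real^'n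
     \<Rightarrow> real^'n \<Rightarrow> real" where
  "quad_model f g \<phi> B x d = f x + g x \<bullet> d + 1/2 * (d \<bullet> (B *v d)) + \<phi> (x + d)"

definition reg_model ::
  "(real^'n \<Rightarrow> real) \<Rightarrow> (real^'n \<Rightarrow> real^'n) \<Rightarrow> (real^'n \<Rightarrow> real) \<Rightarrow> real^'n^'n \<Rightarrow> real \<Rightarrow> real^'n
     \<Rightarrow> real^'n \<Rightarrow> real" where
  "reg_model f g \<phi> B \<mu> x d = quad_model f g \<phi> B x d + 1/2 * \<mu> * (norm d)\<^sup>2"

definition pred_reduction ::
  "(real^'n \<Rightarrow> real) \<Rightarrow> (real^'n \<Rightarrow> real^'n) \<Rightarrow> (real^'n \<Rightarrow> real) \<Rightarrow> real^'n^'n \<Rightarrow> real^'n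
     \<Rightarrow> real^'n \<Rightarrow> real" where
  "pred_reduction f g \<phi> B x d = (f x + \<phi> x) - quad_model f g \<phi> B x d"

definition actual_reduction ::
  "(real^'n \<Rightarrow> real) \<Rightarrow> (real^'n \<Rightarrow> real) \<Rightarrow> real^'n \<Rightarrow> real^'n \<Rightarrow> real" where
  "actual_reduction f \<phi> x d = (f x + \<phi> x) - (f (x + d) + \<phi> (x + d))"

text \<open>
  One iteration: from \<open>(x, \<mu>)\<close>, with matrix \<open>B\<close> and subproblem solution \<open>d\<close>, to \<open>(x', \<mu>')\<close>.
  If the subproblem has no solution, \<open>d\<close> is unconstrained and has no influence on \<open>(x', \<mu>')\<close>.
\<close>

definition rpqn_step ::
  "(real^'n \<Rightarrow> real) \<Rightarrow> (real^'n \<Rightarrow> real^'n) \<Rightarrow> (real^'n \<Rightarrow> real) \<Rightarrow>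
   real \<Rightarrow> real \<Rightarrow> real \<Rightarrow> real \<Rightarrow> real \<Rightarrow> real^'n^'n \<Rightarrow> real^'n \<Rightarrow>
   real^'n \<Rightarrow> real \<Rightarrow> real^'n \<Rightarrow> real \<Rightarrow> bool" where
  "rpqn_step f g \<phi> p_min c1 c2 \<sigma>1 \<sigma>2 B d x \<mu> x' \<mu>' \<longleftrightarrow>
    (let solvable = (\<exists>e. is_arg_min (reg_model f g \<phi> B \<mu> x) (\<lambda>_. True) e);
         prd = pred_reduction f g \<phi> B x d;
         \<rho> = actual_reduction f \<phi> x d / prd
     in (solvable \<longrightarrow> is_arg_min (reg_model f g \<phi> B \<mu> x) (\<lambda>_. True) d) \<and>
        (if \<not> solvable \<or> prd \<le> p_min * norm d * norm (residual g \<phi> x)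
         then x' = x \<and> \<mu>' = \<sigma>2 * \<mu>
         else x' = (if \<rho> \<le> c1 then x else x + d) \<and>
              \<mu>' = (if \<rho> \<le> c1 then \<sigma>2 * \<mu> else if \<rho> \<le> c2 then \<mu> else \<sigma>1 * \<mu>)))"

definition rpqn_sequence ::
  "(real^'n \<Rightarrow> real) \<Rightarrow> (real^'n \<Rightarrow> real^'n) \<Rightarrow> (real^'n \<Rightarrow> real) \<Rightarrow>
   real \<Rightarrow> real \<Rightarrow> real \<Rightarrow> real \<Rightarrow> real \<Rightarrow> (nat \<Rightarrow> real^'n^'n) \<Rightarrow> (nat \<Rightarrow> real^'n) \<Rightarrow>
   (nat \<Rightarrow> real^'n) \<Rightarrow> (nat \<Rightarrow> real) \<Rightarrow> bool" where
  "rpqn_sequence f g \<phi> p_min c1 c2 \<sigma>1 \<sigma>2 B d x \<mu> \<longleftrightarrow>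
     (\<forall>k. rpqn_step f g \<phi> p_min c1 c2 \<sigma>1 \<sigma>2 (B k) (d k) (x k) (\<mu> k) (x (Suc k)) (\<mu> (Suc k)))"

end

theory Submission
  imports Defs
begin

text \<open>
  Suppose the residual norms \<open>\<parallel>r(x\<^sub>k)\<parallel>\<close> do not have lower limit \<open>0\<close>. Then they stay above some
  \<open>\<epsilon> > 0\<close> from some index on, and the following contradiction arises.

  An accepted step decreases the objective \<open>\<psi> = f + \<phi>\<close> by more than
  \<open>c1 * p_min * \<epsilon> * \<parallel>d\<^sub>k\<parallel>\<close>: both acceptance tests are linear in \<open>\<parallel>d\<^sub>k\<parallel>\<close>, thanks to the
  lower bound on the residual (\<open>rpqn_step_descent\<close>). As \<open>\<psi>\<close> is bounded below, the lengths of
  all steps are summable, so the iterates converge (\<open>convergent_if_step_le_decrease\<close>) and in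
  particular stay in a compact set.

  On a compact set, all estimates of a single iteration are uniform. Once the regularization
  parameter \<open>\<mu>\<close> exceeds a threshold, the subproblem is solvable, its solution \<open>d\<close> is
  short, and the predicted reduction is at least \<open>\<mu>/2 * \<parallel>d\<parallel>\<^sup>2\<close>. The residual is at most
  \<open>(2 + M + \<mu>) * \<parallel>d\<parallel>\<close>, where \<open>M\<close> bounds the matrices (\<open>residual_le_step\<close>), and
  \<open>(\<mu>/2) / (2 + M + \<mu>)\<close> tends to \<open>1/2 > p_min\<close>; hence the first test succeeds. The second
  succeeds too, because the model error is \<open>o(\<parallel>d\<parallel>)\<close> while the predicted reduction exceeds
  \<open>p_min * \<epsilon> * \<parallel>d\<parallel>\<close>. So the parameter does not increase above the threshold
  (\<open>rpqn_step_parameter_threshold\<close>), and \<open>\<mu>\<^sub>k\<close> is bounded, say by \<open>U\<close>.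

  But then every accepted step has length at least \<open>\<epsilon> / (2 + M + U)\<close>, which is
  incompatible with convergence of the iterates unless all late steps are rejected. A rejected
  step multiplies \<open>\<mu>\<^sub>k\<close> by \<open>\<sigma>2 > 1\<close>, so \<open>\<mu>\<^sub>k\<close> would be unbounded after all.
\<close>

section \<open>Preliminary estimates\<close>

lemma bounded_matrices_operator_bound:
  fixes B :: "'k \<Rightarrow> real^'n^'m"
  assumes "bounded (range B)"
  obtains M where "0 < M" "\<And>k v. norm (B k *v v) \<le> M * norm v"
proof -
  obtain b where b: "0 < b" "\<And>k. norm (B k) \<le> b"
    using assms by (auto simp: bounded_pos)
  define M where "M = real CARD('m) * real CARD('n) * b"
  have "norm (B k *v v) \<le> M * norm v" for k v
  proof -
    have "\<bar>B k $ i $ j\<bar> \<le> b" for i j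
      using component_le_norm_cart[of "B k $ i" j] Finite_Cartesian_Product.norm_nth_le[of "B k" i] b(2)[of k] by linarith
    then have "onorm ((*v) (B k)) \<le> M"
      unfolding M_def by (rule onorm_le_matrix_component)
    moreover have "norm (B k *v v) \<le> onorm ((*v) (B k)) * norm v"
      by (rule onorm) (simp add: linear_linear)
    ultimately show ?thesis
      by (meson mult_right_mono norm_ge_zero order_trans)
  qed
  moreover have "0 < M"
    using b(1) by (simp add: M_def)
  ultimately show thesis
    using that by blast
qed

lemma abs_quadratic_form_le:
  fixes B :: "real^'n^'n"
  assumes "norm (B *v d) \<le> M * norm d"
  shows "\<bar>d \<bullet> (B *v d)\<bar> \<le> M * (norm d)\<^sup>2"
proof -
  have "\<bar>d \<bullet> (B *v d)\<bar> \<le> norm d * norm (B *v d)"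
    by (rule Cauchy_Schwarz_ineq2)
  also have "\<dots> \<le> norm d * (M * norm d)"
    using assms by (rule mult_left_mono) simp
  finally show ?thesis
    by (simp add: power2_eq_square mult_ac)
qed

lemma symmetric_matrix_inner:
  fixes B :: "real^'n^'n"
  assumes "transpose B = B"
  shows "u \<bullet> (B *v v) = v \<bullet> (B *v u)"
  by (metis assms dot_lmul_matrix inner_commute vector_transpose_matrix)

text \<open>
  Convexity along the line through \<open>x - u\<close>, \<open>x\<close> and \<open>x + d\<close>, with \<open>u\<close> the unit vector in
  direction \<open>d\<close>, shows that the slope beyond \<open>x\<close> is at least \<open>\<phi> x - \<phi> (x - u)\<close>. This
  replaces an affine minorant given by a subgradient at \<open>x\<close>, and its constant is uniform as long
  as \<open>\<phi>\<close> is bounded near \<open>x\<close>, which makes it usable for all points of a compact set at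
  once.
\<close>

lemma convex_on_linear_lower_bound:
  fixes \<phi> :: "'a::real_normed_vector \<Rightarrow> real"
  assumes "convex_on UNIV \<phi>" and S: "\<And>y. norm (y - x) \<le> 1 \<Longrightarrow> \<bar>\<phi> y\<bar> \<le> S"
  shows "\<phi> x - 2 * S * norm d \<le> \<phi> (x + d)"
proof (cases "d = 0")
  case False
  define t where "t = norm d"
  define u where "u = (1 / t) *\<^sub>R d"
  have t: "0 < t" and d: "d = t *\<^sub>R u" and u: "norm u = 1"
    using False by (auto simp: t_def u_def)
  \<comment> \<open>\<open>x\<close> is the convex combination of \<open>x + d\<close> and \<open>x - u\<close> with weights \<open>1 : t\<close>.\<close>
  have "(1 - t / (1 + t)) *\<^sub>R (x + d) + (t / (1 + t)) *\<^sub>R (x - u)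
      = x + ((1 - t / (1 + t)) * t - t / (1 + t)) *\<^sub>R u"
    by (simp add: d algebra_simps)
  also have "(1 - t / (1 + t)) * t - t / (1 + t) = 0"
    using t by (simp add: field_simps)
  finally have "\<phi> x \<le> (1 - t / (1 + t)) * \<phi> (x + d) + t / (1 + t) * \<phi> (x - u)"
    using convex_onD[OF assms(1), of "t / (1 + t)" "x + d" "x - u"] t by simp
  also have "\<dots> = (\<phi> (x + d) + t * \<phi> (x - u)) / (1 + t)"
    using t by (simp add: divide_simps)
  finally have "(1 + t) * \<phi> x \<le> \<phi> (x + d) + t * \<phi> (x - u)"
    using t by (simp add: pos_le_divide_eq mult.commute)
  moreover have "t * (\<phi> (x - u) - \<phi> x) \<le> t * (2 * S)"
    using t S[of "x - u"] S[of x] u by (intro mult_left_mono) auto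
  ultimately show ?thesis
    by (simp add: t_def algebra_simps)
qed simp

text \<open>
  The mean value inequality, applied to \<open>f\<close> minus its linearization. Only the oscillation of
  the gradient enters, so uniform continuity of \<open>g\<close> on a compact set gives a uniform
  \<open>o(\<parallel>d\<parallel>)\<close> remainder.
\<close>

lemma gradient_linearization_error:
  fixes f :: "'a::real_inner \<Rightarrow> real"
  assumes f: "\<And>y. GDERIV f y :> g y"
    and \<eta>: "\<And>z. norm (z - x) \<le> norm d \<Longrightarrow> norm (g z - g x) \<le> \<eta>"
  shows "\<bar>f (x + d) - f x - g x \<bullet> d\<bar> \<le> \<eta> * norm d"
proof -
  have "norm (f (x + d) - f x - (x + d - x) \<bullet> g x) \<le> norm (x + d - x) * \<eta>"
  proof (rule differentiable_bound_linearization
      [where S = "cball x (norm d)" and f' = "\<lambda>z h. h \<bullet> g z" and ?x0.0 = x])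
    show "x + t *\<^sub>R (x + d - x) \<in> cball x (norm d)" if "t \<in> {0..1}" for t
      using that by (auto simp: dist_norm intro: mult_left_le_one_le)
    show "(f has_derivative (\<lambda>h. h \<bullet> g z)) (at z within cball x (norm d))" for z
      using f[of z] unfolding gderiv_def by (rule has_derivative_at_withinI)
    show "onorm ((\<lambda>h. h \<bullet> g z) - (\<lambda>h. h \<bullet> g x)) \<le> \<eta>" if "z \<in> cball x (norm d)" for z
    proof (rule onorm_bound)
      fix h :: 'a
      have "norm (g z - g x) \<le> \<eta>"
        using that \<eta>[of z] by (simp add: dist_norm norm_minus_commute)
      then have "norm h * norm (g z - g x) \<le> norm h * \<eta>"
        by (rule mult_left_mono) simp
      then show "norm (((\<lambda>h. h \<bullet> g z) - (\<lambda>h. h \<bullet> g x)) h) \<le> \<eta> * norm h"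
        using Cauchy_Schwarz_ineq2[of h "g z - g x"] by (simp add: inner_diff_right mult.commute)
    qed (use \<eta>[of x] in simp)
  qed simp
  then show ?thesis
    by (simp add: inner_commute mult.commute)
qed

section \<open>The regularized subproblem\<close>

lemma reg_model_zero [simp]: "reg_model f g \<phi> B \<mu> x 0 = f x + \<phi> x"
  by (simp add: reg_model_def quad_model_def)

text \<open>
  For \<open>\<mu> > M\<close> the quadratic part grows at least like \<open>(\<mu> - M)/2 * \<parallel>d\<parallel>\<^sup>2\<close>, whereas the
  linear part and \<open>\<phi>\<close> decrease at most linearly. Outside a ball the model therefore exceeds
  its value at \<open>0\<close>, and inside the ball compactness provides a minimizer.
\<close>

lemma reg_model_minimizer_exists:
  assumes \<phi>: "convex_on UNIV \<phi>" and B: "\<And>v. norm (B *v v) \<le> M * norm v" and "M < \<mu>"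
  shows "\<exists>e. is_arg_min (reg_model f g \<phi> B \<mu> x) (\<lambda>_. True) e"
proof -
  let ?h = "reg_model f g \<phi> B \<mu> x"
  have cont_\<phi>: "continuous_on UNIV \<phi>"
    using \<phi> by (rule convex_on_continuous[OF open_UNIV])
  then have "continuous_on (cball x 1) \<phi>"
    by (rule continuous_on_subset) simp
  then have "bounded (\<phi> ` cball x 1)"
    by (intro compact_imp_bounded compact_continuous_image) auto
  then obtain S where S: "0 < S" "\<And>y. norm (y - x) \<le> 1 \<Longrightarrow> \<bar>\<phi> y\<bar> \<le> S"
    by (auto simp: bounded_pos dist_norm norm_minus_commute)
  \<comment> \<open>At norm \<open>R\<close> the quadratic growth has caught up with the linear decrease.\<close>
  define R where "R = 2 * (norm (g x) + 2 * S) / (\<mu> - M)"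
  have "0 \<le> R"
    using S(1) \<open>M < \<mu>\<close> by (simp add: R_def)
  have "continuous_on UNIV (\<lambda>d. \<phi> (x + d))"
    by (rule continuous_on_compose2[OF cont_\<phi>]) (auto intro!: continuous_intros)
  then have "continuous_on UNIV ?h"
    unfolding reg_model_def quad_model_def
    by (intro continuous_intros matrix_vector_mult_linear_continuous_on) auto
  then have "continuous_on (cball 0 R) ?h"
    by (rule continuous_on_subset) simp
  then obtain e where e: "\<And>y. y \<in> cball 0 R \<Longrightarrow> ?h e \<le> ?h y"
    using continuous_attains_inf[of "cball 0 R" ?h] \<open>0 \<le> R\<close>
    by (metis cball_eq_empty compact_cball not_less)
  have "?h e \<le> ?h d" for d
  proof (cases "norm d \<le> R")
    case False
    have "(\<mu> - M) * norm d \<ge> 2 * (norm (g x) + 2 * S)"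
      using False \<open>M < \<mu>\<close> by (simp add: R_def field_simps)
    then have "((\<mu> - M) * norm d) * norm d \<ge> 2 * (norm (g x) + 2 * S) * norm d"
      by (rule mult_right_mono) simp
    then have "(\<mu> - M) * (norm d)\<^sup>2 / 2 \<ge> norm (g x) * norm d + 2 * S * norm d"
      by (simp add: power2_eq_square algebra_simps)
    moreover have "\<bar>g x \<bullet> d\<bar> \<le> norm (g x) * norm d"
      by (rule Cauchy_Schwarz_ineq2)
    moreover have "\<bar>d \<bullet> (B *v d)\<bar> \<le> M * (norm d)\<^sup>2"
      by (rule abs_quadratic_form_le) (rule B)
    moreover have "\<phi> x - 2 * S * norm d \<le> \<phi> (x + d)"
      using \<phi> S(2) by (rule convex_on_linear_lower_bound)
    ultimately have "?h 0 \<le> ?h d"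
      unfolding reg_model_zero by (simp add: reg_model_def quad_model_def algebra_simps)
    then show ?thesis
      using e[of 0] \<open>0 \<le> R\<close> by simp
  qed (use e in simp)
  then show ?thesis
    by (auto simp: is_arg_min_linorder)
qed

text \<open>
  The first-order optimality condition, with the subgradient inclusion
  \<open>-(g x + B d + \<mu> d) \<in> \<partial>\<phi>(x + d)\<close> written out as an inequality. It follows by moving
  from \<open>d\<close> a fraction \<open>t\<close> of the way towards \<open>y\<close>, dividing by \<open>t\<close> and letting
  \<open>t\<close> tend to \<open>0\<close>. The model itself may be nonconvex, as \<open>B\<close> may be indefinite.
\<close>

lemma reg_model_variational_inequality:
  assumes \<phi>: "convex_on UNIV \<phi>" and sym: "transpose B = B"
    and d: "is_arg_min (reg_model f g \<phi> B \<mu> x) (\<lambda>_. True) d"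
  shows "0 \<le> (g x + B *v d + \<mu> *\<^sub>R d) \<bullet> (y - d) + \<phi> (x + y) - \<phi> (x + d)"
proof -
  define w where "w = y - d"
  define A where "A = (g x + B *v d + \<mu> *\<^sub>R d) \<bullet> w + \<phi> (x + y) - \<phi> (x + d)"
  define Q where "Q = 1/2 * (w \<bullet> (B *v w)) + 1/2 * \<mu> * (norm w)\<^sup>2"
  \<comment> \<open>\<open>A + t * Q\<close> bounds the difference quotient of the model in direction \<open>w\<close> from above.\<close>
  have *: "0 \<le> A + t * Q" if t: "0 < t" "t < 1" for t
  proof -
    have "x + (d + t *\<^sub>R w) = (1 - t) *\<^sub>R (x + d) + t *\<^sub>R (x + y)"
      by (simp add: w_def algebra_simps)
    then have "\<phi> (x + (d + t *\<^sub>R w)) \<le> (1 - t) * \<phi> (x + d) + t * \<phi> (x + y)"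
      using convex_onD[OF \<phi>, of t "x + d" "x + y"] t by simp
    moreover have "reg_model f g \<phi> B \<mu> x d \<le> reg_model f g \<phi> B \<mu> x (d + t *\<^sub>R w)"
      using d by (simp add: is_arg_min_linorder)
    moreover have "reg_model f g \<phi> B \<mu> x (d + t *\<^sub>R w) = reg_model f g \<phi> B \<mu> x d
        + t * (A + t * Q) - (t * (\<phi> (x + y) - \<phi> (x + d)) + \<phi> (x + d)) + \<phi> (x + (d + t *\<^sub>R w))"
    proof -
      have quad: "(d + t *\<^sub>R w) \<bullet> (B *v (d + t *\<^sub>R w))
          = d \<bullet> (B *v d) + 2 * t * (w \<bullet> (B *v d)) + t * t * (w \<bullet> (B *v w))"
        by (simp add: matrix_vector_right_distrib matrix_vector_mult_scaleR inner_add_left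
            inner_add_right symmetric_matrix_inner[OF sym, of d w] distrib_left)
      have sq: "(norm (d + t *\<^sub>R w))\<^sup>2 = (norm d)\<^sup>2 + 2 * t * (d \<bullet> w) + t * t * (norm w)\<^sup>2"
        by (simp add: power2_norm_eq_inner inner_add_left inner_add_right inner_commute algebra_simps)
      have A: "A = g x \<bullet> w + w \<bullet> (B *v d) + \<mu> * (d \<bullet> w) + \<phi> (x + y) - \<phi> (x + d)"
        by (simp add: A_def inner_add_left inner_commute[of "B *v d" w])
      show ?thesis
        unfolding reg_model_def quad_model_def Q_def quad sq A
        by (simp add: inner_add_right algebra_simps)
    qed
    ultimately have "0 \<le> t * (A + t * Q)"
      by (simp add: left_diff_distrib right_diff_distrib)
    then show ?thesis
      using t by (simp add: zero_le_mult_iff)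
  qed
  have "((\<lambda>t. A + t * Q) \<longlongrightarrow> A + 0 * Q) (at_right 0)"
    by (intro tendsto_intros)
  moreover have "\<forall>\<^sub>F t in at_right 0. 0 \<le> A + t * Q"
    using eventually_at_right_real[OF zero_less_one]
    by eventually_elim (auto intro: *)
  ultimately have "0 \<le> A + 0 * Q"
    by (intro tendsto_lowerbound) auto
  then show ?thesis
    by (simp add: A_def w_def)
qed

text \<open>
  The residual is the subproblem solution for \<open>B = 0\<close> and \<open>\<mu> = 1\<close>. This makes the
  existence result and the variational inequality for subproblems available for it.
\<close>

lemma is_arg_min_residual:
  assumes "convex_on UNIV \<phi>"
  shows "is_arg_min (reg_model f g \<phi> 0 1 x) (\<lambda>_. True) (residual g \<phi> x)"
proof -
  let ?h = "\<lambda>d. g x \<bullet> d + 1/2 * (d \<bullet> (mat 1 *v d)) + \<phi> (x + d)"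
  have h: "reg_model f g \<phi> 0 1 x d = f x + ?h d" for d
    by (simp add: reg_model_def quad_model_def power2_norm_eq_inner)
  obtain e where "is_arg_min (reg_model f g \<phi> 0 1 x) (\<lambda>_. True) e"
    using reg_model_minimizer_exists[OF assms, of 0 0 1 f g x] by auto
  then have "\<exists>e. is_arg_min ?h (\<lambda>d. d \<in> UNIV) e"
    by (auto simp: is_arg_min_linorder h)
  then have "is_arg_min ?h (\<lambda>d. d \<in> UNIV) (residual g \<phi> x)"
    unfolding residual_def residual_wrt_def arg_min_on_def arg_min_def by (rule someI_ex)
  then show ?thesis
    by (simp add: is_arg_min_linorder h)
qed

text \<open>
  Testing the variational inequality of each of \<open>d\<close> and \<open>r\<close> (the residual) with the other
  point and adding them cancels \<open>g x\<close> and the values of \<open>\<phi>\<close>; this is monotonicity of the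
  subdifferential. What remains is \<open>0 \<le> (r - h) \<bullet> (d - r)\<close> with
  \<open>h = B d + \<mu> d\<close>, whence \<open>\<parallel>d - r\<parallel> \<le> \<parallel>d - h\<parallel>\<close>.
\<close>

lemma residual_le_step:
  assumes \<phi>: "convex_on UNIV \<phi>" and sym: "transpose B = B"
    and B: "norm (B *v d) \<le> M * norm d" and "0 \<le> \<mu>"
    and d: "is_arg_min (reg_model f g \<phi> B \<mu> x) (\<lambda>_. True) d"
  shows "norm (residual g \<phi> x) \<le> (2 + M + \<mu>) * norm d"
proof -
  define r where "r = residual g \<phi> x"
  define h where "h = B *v d + \<mu> *\<^sub>R d"
  have "transpose (0 :: real^'n^'n) = 0"
    by (simp add: transpose_def vec_eq_iff)
  from reg_model_variational_inequality[OF \<phi> this is_arg_min_residual[OF \<phi>], of g x d]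
    reg_model_variational_inequality[OF \<phi> sym d, of r]
  have "0 \<le> (r - h) \<bullet> (d - r)"
    by (simp add: r_def h_def inner_add_left inner_diff_left inner_diff_right algebra_simps)
  then have "(norm (d - r))\<^sup>2 \<le> (d - h) \<bullet> (d - r)"
    by (simp add: power2_norm_eq_inner inner_diff_left)
  also have "\<dots> \<le> norm (d - h) * norm (d - r)"
    by (rule norm_cauchy_schwarz)
  finally have "norm (d - r) \<le> norm (d - h)"
    by (cases "d = r") (auto simp: power2_eq_square)
  moreover have "norm (d - h) \<le> norm d + norm h"
    by (rule norm_triangle_ineq4)
  moreover have "norm h \<le> norm (B *v d) + \<mu> * norm d"
    using norm_triangle_ineq[of "B *v d" "\<mu> *\<^sub>R d"] \<open>0 \<le> \<mu>\<close> by (simp add: h_def)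
  moreover have "norm r \<le> norm d + norm (d - r)"
    using norm_triangle_ineq4[of d "d - r"] by simp
  ultimately show ?thesis
    using B by (simp add: r_def algebra_simps)
qed

text \<open>
  The regularized model at its minimizer does not exceed its value \<open>f x + \<phi> x\<close> at \<open>0\<close>; the
  regularization term is the gain.
\<close>

lemma pred_reduction_lower_bound:
  assumes "is_arg_min (reg_model f g \<phi> B \<mu> x) (\<lambda>_. True) d"
  shows "\<mu> / 2 * (norm d)\<^sup>2 \<le> pred_reduction f g \<phi> B x d"
proof -
  have "reg_model f g \<phi> B \<mu> x d \<le> reg_model f g \<phi> B \<mu> x 0"
    using assms unfolding is_arg_min_linorder by blast
  then show ?thesis
    unfolding reg_model_zero by (simp add: reg_model_def pred_reduction_def)
qed

text \<open>
  The predicted reduction is at least \<open>\<mu>/2 * \<parallel>d\<parallel>\<^sup>2\<close>, and at most linear in \<open>\<parallel>d\<parallel>\<close> up to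
  the curvature \<open>M/2 * \<parallel>d\<parallel>\<^sup>2\<close>. Hence steps shrink like \<open>1/\<mu>\<close>.
\<close>

lemma step_bound:
  assumes \<phi>: "convex_on UNIV \<phi>" and S: "\<And>y. norm (y - x) \<le> 1 \<Longrightarrow> \<bar>\<phi> y\<bar> \<le> S"
    and B: "norm (B *v d) \<le> M * norm d"
    and d: "is_arg_min (reg_model f g \<phi> B \<mu> x) (\<lambda>_. True) d"
  shows "(\<mu> - M) * norm d \<le> 2 * (norm (g x) + 2 * S)"
proof (cases "d = 0")
  case True
  then show ?thesis
    using S[of x] by simp
next
  case False
  have lower: "\<phi> x - 2 * S * norm d \<le> \<phi> (x + d)"
    using \<phi> S by (rule convex_on_linear_lower_bound)
  have "pred_reduction f g \<phi> B x d \<le> norm (g x) * norm d + M / 2 * (norm d)\<^sup>2 + 2 * S * norm d"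
    using abs_quadratic_form_le[OF B] lower
      Cauchy_Schwarz_ineq2[of "g x" d]
    by (simp add: pred_reduction_def quad_model_def)
  with pred_reduction_lower_bound[OF d]
  have "(\<mu> - M) * norm d * norm d \<le> 2 * (norm (g x) + 2 * S) * norm d"
    by (simp add: power2_eq_square algebra_simps)
  then show ?thesis
    using False by (simp add: mult_le_cancel_right)
qed

section \<open>One iteration\<close>

lemma rpqn_step_cases:
  assumes "rpqn_step f g \<phi> p_min c1 c2 \<sigma>1 \<sigma>2 B d x \<mu> x' \<mu>'" and "0 \<le> p_min"
  obtains (rejected) "x' = x" "\<mu>' = \<sigma>2 * \<mu>"
  | (accepted) "is_arg_min (reg_model f g \<phi> B \<mu> x) (\<lambda>_. True) d" "x' = x + d"
      "p_min * norm d * norm (residual g \<phi> x) < pred_reduction f g \<phi> B x d"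
      "c1 * pred_reduction f g \<phi> B x d < actual_reduction f \<phi> x d"
      "\<mu>' = \<mu> \<or> \<mu>' = \<sigma>1 * \<mu>"
proof -
  let ?prd = "pred_reduction f g \<phi> B x d"
  let ?ard = "actual_reduction f \<phi> x d"
  let ?thr = "p_min * norm d * norm (residual g \<phi> x)"
  have pos: "0 < ?prd" if "?thr < ?prd"
    using that \<open>0 \<le> p_min\<close>
    by (meson mult_nonneg_nonneg norm_ge_zero order_le_less_trans)
  show thesis
  proof (cases "(\<exists>e. is_arg_min (reg_model f g \<phi> B \<mu> x) (\<lambda>_. True) e) \<and> ?thr < ?prd
      \<and> c1 < ?ard / ?prd")
    case True
    then have "c1 * ?prd < ?ard"
      using pos by (simp add: pos_less_divide_eq)
    then show thesis
      using True assms(1) unfolding rpqn_step_def Let_def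
      by (intro accepted) (auto split: if_splits)
  next
    case False
    then show thesis
      using assms(1) unfolding rpqn_step_def Let_def
      by (intro rejected) (auto simp: not_less split: if_splits)
  qed
qed

text \<open>
  For a solvable subproblem, \<open>d\<close> is a minimizer, so it suffices to verify the two acceptance
  tests for minimizers.
\<close>

lemma rpqn_step_parameter_le_if_accepted:
  assumes "rpqn_step f g \<phi> p_min c1 c2 \<sigma>1 \<sigma>2 B d x \<mu> x' \<mu>'" and "0 \<le> p_min"
    and "is_arg_min (reg_model f g \<phi> B \<mu> x) (\<lambda>_. True) e"
    and "is_arg_min (reg_model f g \<phi> B \<mu> x) (\<lambda>_. True) d \<Longrightarrow>
      p_min * norm d * norm (residual g \<phi> x) < pred_reduction f g \<phi> B x d"
    and "is_arg_min (reg_model f g \<phi> B \<mu> x) (\<lambda>_. True) d \<Longrightarrow>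
      c1 * pred_reduction f g \<phi> B x d < actual_reduction f \<phi> x d"
    and "0 \<le> \<mu>" "\<sigma>1 \<le> 1"
  shows "\<mu>' \<le> \<mu>"
proof -
  let ?prd = "pred_reduction f g \<phi> B x d"
  let ?ard = "actual_reduction f \<phi> x d"
  have d: "is_arg_min (reg_model f g \<phi> B \<mu> x) (\<lambda>_. True) d"
    using assms(1,3) unfolding rpqn_step_def Let_def by blast
  have "0 < ?prd"
    using assms(4)[OF d] \<open>0 \<le> p_min\<close>
    by (meson mult_nonneg_nonneg norm_ge_zero order_le_less_trans)
  then have "c1 < ?ard / ?prd"
    using assms(5)[OF d] by (simp add: pos_less_divide_eq)
  moreover have "\<sigma>1 * \<mu> \<le> \<mu>"
    using \<open>0 \<le> \<mu>\<close> \<open>\<sigma>1 \<le> 1\<close> by (simp add: mult_right_mono[of \<sigma>1 1 \<mu>, simplified])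
  ultimately show ?thesis
    using assms(1,3) assms(4)[OF d] unfolding rpqn_step_def Let_def
    by (auto split: if_splits)
qed

text \<open>
  An accepted step has \<open>ared \<ge> c1 * pred \<ge> c1 * p_min * \<parallel>d\<parallel> * \<parallel>r(x)\<parallel>\<close>; a rejected one leaves
  both sides zero.
\<close>

lemma rpqn_step_descent:
  assumes "rpqn_step f g \<phi> p_min c1 c2 \<sigma>1 \<sigma>2 B d x \<mu> x' \<mu>'"
    and "0 \<le> p_min" "0 \<le> c1" and \<epsilon>: "\<epsilon> \<le> norm (residual g \<phi> x)"
  shows "c1 * p_min * \<epsilon> * norm (x' - x) \<le> (f x + \<phi> x) - (f x' + \<phi> x')"
  using assms(1,2)
proof (cases rule: rpqn_step_cases)
  case accepted
  have "p_min * norm d * \<epsilon> \<le> p_min * norm d * norm (residual g \<phi> x)"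
    using \<epsilon> \<open>0 \<le> p_min\<close> by (simp add: mult_left_mono)
  then have "c1 * (p_min * norm d * \<epsilon>) \<le> c1 * pred_reduction f g \<phi> B x d"
    using accepted(3) \<open>0 \<le> c1\<close> by (intro mult_left_mono) auto
  then show ?thesis
    using accepted(2,4) by (simp add: actual_reduction_def mult_ac)
qed simp

text \<open>
  For iterates in a compact set with residuals bounded away from zero, a large parameter forces
  acceptance, uniformly in the iterate and in the matrix. The bounds on \<open>\<phi>\<close> and \<open>g\<close> are
  taken on the closed \<open>1\<close>-neighbourhood \<open>C1\<close> of the compact set, since steps leave that
  set.
\<close>

lemma rpqn_step_parameter_threshold:
  fixes f :: "real^'n \<Rightarrow> real" and C :: "(real^'n) set"
  assumes f: "\<And>y. GDERIV f y :> g y" and g: "continuous_on UNIV g" and \<phi>: "convex_on UNIV \<phi>"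
    and "compact C" and "0 < \<epsilon>" and "0 < M"
    and p: "0 < p_min" "p_min < 1/2" and c1: "c1 < 1" and \<sigma>1: "\<sigma>1 \<le> 1"
  obtains T where
    "\<And>B d x \<mu> x' \<mu>'. rpqn_step f g \<phi> p_min c1 c2 \<sigma>1 \<sigma>2 B d x \<mu> x' \<mu>' \<Longrightarrow> x \<in> C \<Longrightarrow>
       \<epsilon> \<le> norm (residual g \<phi> x) \<Longrightarrow> transpose B = B \<Longrightarrow> (\<And>v. norm (B *v v) \<le> M * norm v) \<Longrightarrow>
       T \<le> \<mu> \<Longrightarrow> \<mu>' \<le> \<mu>"
proof -
  define C1 where "C1 = {u + v |u v. u \<in> C \<and> v \<in> cball 0 1}"
  have "compact C1"
    unfolding C1_def using \<open>compact C\<close> by (intro compact_sums) auto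
  have C1: "z \<in> C1" if "x \<in> C" "norm (z - x) \<le> 1" for x z
    unfolding C1_def using that by (intro CollectI exI[of _ x] exI[of _ "z - x"]) auto
  have cont_\<phi>: "continuous_on C1 \<phi>" and cont_g: "continuous_on C1 g"
    using convex_on_continuous[OF open_UNIV \<phi>] g by (auto intro: continuous_on_subset)
  obtain S where S: "0 < S" "\<And>z. z \<in> C1 \<Longrightarrow> \<bar>\<phi> z\<bar> \<le> S"
    using compact_imp_bounded[OF compact_continuous_image[OF cont_\<phi> \<open>compact C1\<close>]]
    by (auto simp: bounded_pos)
  obtain G where G: "0 < G" "\<And>z. z \<in> C1 \<Longrightarrow> norm (g z) \<le> G"
    using compact_imp_bounded[OF compact_continuous_image[OF cont_g \<open>compact C1\<close>]]
    by (auto simp: bounded_pos)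
  \<comment> \<open>\<open>\<eta> * \<parallel>d\<parallel>\<close> bounds both the linearization error of \<open>f\<close> and the term \<open>1/2 * (d \<bullet> B d)\<close>
    separately; their sum \<open>2 * \<eta> * \<parallel>d\<parallel>\<close> is what the second acceptance test tolerates.\<close>
  define \<eta> where "\<eta> = (1 - c1) * p_min * \<epsilon> / 2"
  have "0 < \<eta>"
    using c1 p \<open>0 < \<epsilon>\<close> by (simp add: \<eta>_def)
  then obtain \<delta>0 where \<delta>0: "0 < \<delta>0"
    "\<And>x z. x \<in> C1 \<Longrightarrow> z \<in> C1 \<Longrightarrow> dist z x < \<delta>0 \<Longrightarrow> dist (g z) (g x) < \<eta>"
    using compact_uniformly_continuous[OF cont_g \<open>compact C1\<close>]
    unfolding uniformly_continuous_on_def by metis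
  define \<delta> where "\<delta> = min 1 (min (\<delta>0 / 2) (2 * \<eta> / M))"
  have "0 < \<delta>"
    using \<delta>0(1) \<open>0 < \<eta>\<close> \<open>0 < M\<close> by (simp add: \<delta>_def)
  \<comment> \<open>The first term forces \<open>\<parallel>d\<parallel> \<le> \<delta>\<close>; the second one solves
    \<open>p_min * (2 + M + \<mu>) < \<mu> / 2\<close> for \<open>\<mu>\<close>.\<close>
  define T where
    "T = max (M + 2 * (G + 2 * S) / \<delta>) (1 + 2 * p_min * (2 + M) / (1 - 2 * p_min))"
  show thesis
  proof (rule that[of T])
    fix B :: "real^'n^'n" and d x :: "real^'n" and \<mu> x' \<mu>'
    assume step: "rpqn_step f g \<phi> p_min c1 c2 \<sigma>1 \<sigma>2 B d x \<mu> x' \<mu>'" and "x \<in> C"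
      and \<epsilon>: "\<epsilon> \<le> norm (residual g \<phi> x)" and sym: "transpose B = B"
      and B: "\<And>v. norm (B *v v) \<le> M * norm v" and "T \<le> \<mu>"
    have "x \<in> C1"
      using C1[of x x] \<open>x \<in> C\<close> by simp
    have "0 < 2 * (G + 2 * S) / \<delta>"
      using G S \<open>0 < \<delta>\<close> by simp
    moreover have \<mu>1: "M + 2 * (G + 2 * S) / \<delta> \<le> \<mu>"
      using \<open>T \<le> \<mu>\<close> by (simp add: T_def)
    ultimately have "M < \<mu>"
      by linarith
    have "2 * p_min * (2 + M) / (1 - 2 * p_min) < \<mu>"
      using \<open>T \<le> \<mu>\<close> by (simp add: T_def)
    then have \<mu>2: "p_min * (2 + M + \<mu>) < \<mu> / 2"
      using p by (simp add: field_simps)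
    obtain e where e: "is_arg_min (reg_model f g \<phi> B \<mu> x) (\<lambda>_. True) e"
      using reg_model_minimizer_exists[OF \<phi> B \<open>M < \<mu>\<close>] by blast
    show "\<mu>' \<le> \<mu>"
    proof (rule rpqn_step_parameter_le_if_accepted[OF step _ e])
      assume d: "is_arg_min (reg_model f g \<phi> B \<mu> x) (\<lambda>_. True) d"
      have r: "norm (residual g \<phi> x) \<le> (2 + M + \<mu>) * norm d"
        using \<open>M < \<mu>\<close> \<open>0 < M\<close> by (intro residual_le_step[OF \<phi> sym B _ d]) simp
      have "0 < norm d"
        using r \<epsilon> \<open>0 < \<epsilon>\<close> by (cases "d = 0") auto
      have "p_min * norm d * norm (residual g \<phi> x) \<le> p_min * norm d * ((2 + M + \<mu>) * norm d)"
        using r p by (intro mult_left_mono) auto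
      also have "\<dots> = p_min * (2 + M + \<mu>) * (norm d)\<^sup>2"
        by (simp add: power2_eq_square)
      also have "\<dots> < \<mu> / 2 * (norm d)\<^sup>2"
        using \<mu>2 \<open>0 < norm d\<close> by (intro mult_strict_right_mono) auto
      also have "\<dots> \<le> pred_reduction f g \<phi> B x d"
        using d by (rule pred_reduction_lower_bound)
      finally show pred: "p_min * norm d * norm (residual g \<phi> x) < pred_reduction f g \<phi> B x d" .
      have "(\<mu> - M) * norm d \<le> 2 * (norm (g x) + 2 * S)"
        using \<phi> _ B d by (rule step_bound) (auto intro: S C1 \<open>x \<in> C\<close>)
      also have "\<dots> \<le> 2 * (G + 2 * S)"
        using G(2)[OF \<open>x \<in> C1\<close>] by simp
      also have "\<dots> \<le> (\<mu> - M) * \<delta>"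
        using \<mu>1 \<open>0 < \<delta>\<close> by (simp add: field_simps)
      finally have "norm d \<le> \<delta>"
        using \<open>M < \<mu>\<close> by simp
      have "\<bar>f (x + d) - f x - g x \<bullet> d\<bar> \<le> \<eta> * norm d"
      proof (rule gradient_linearization_error[OF f])
        fix z assume z: "norm (z - x) \<le> norm d"
        then have "z \<in> C1" "dist z x < \<delta>0"
          using \<open>norm d \<le> \<delta>\<close> \<delta>0(1) C1[OF \<open>x \<in> C\<close>] by (auto simp: \<delta>_def dist_norm)
        then show "norm (g z - g x) \<le> \<eta>"
          using \<delta>0(2)[OF \<open>x \<in> C1\<close>] by (simp add: dist_norm less_imp_le)
      qed
      moreover have "\<bar>d \<bullet> (B *v d)\<bar> \<le> 2 * \<eta> * norm d"
      proof -
        have "\<bar>d \<bullet> (B *v d)\<bar> \<le> (M * norm d) * norm d"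
          using abs_quadratic_form_le[OF B] by (simp add: power2_eq_square mult_ac)
        moreover have "M * norm d \<le> 2 * \<eta>"
          using \<open>norm d \<le> \<delta>\<close> \<open>0 < M\<close> by (simp add: \<delta>_def field_simps)
        ultimately show ?thesis
          by (meson mult_right_mono norm_ge_zero order_trans)
      qed
      ultimately have "pred_reduction f g \<phi> B x d - 2 * \<eta> * norm d \<le> actual_reduction f \<phi> x d"
        by (simp add: pred_reduction_def actual_reduction_def quad_model_def)
      moreover have "2 * \<eta> * norm d < (1 - c1) * pred_reduction f g \<phi> B x d"
      proof -
        have "p_min * norm d * \<epsilon> \<le> p_min * norm d * norm (residual g \<phi> x)"
          using \<epsilon> p by (simp add: mult_left_mono)
        then have "p_min * norm d * \<epsilon> < pred_reduction f g \<phi> B x d"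
          using pred by linarith
        then have "(1 - c1) * (p_min * norm d * \<epsilon>) < (1 - c1) * pred_reduction f g \<phi> B x d"
          using c1 by (intro mult_strict_left_mono) auto
        moreover have "2 * \<eta> * norm d = (1 - c1) * (p_min * norm d * \<epsilon>)"
          by (simp add: \<eta>_def)
        ultimately show ?thesis
          by linarith
      qed
      ultimately show "c1 * pred_reduction f g \<phi> B x d < actual_reduction f \<phi> x d"
        by (simp add: algebra_simps)
    qed (use p \<sigma>1 \<open>M < \<mu>\<close> \<open>0 < M\<close> in auto)
  qed
qed

section \<open>Global convergence\<close>

text \<open>
  Telescoping bounds the distance between two late members of the sequence by a multiple of the
  difference of the corresponding values of \<open>\<Psi>\<close>. These values are eventually decreasing and
  bounded below, hence form a Cauchy sequence.
\<close>

lemma convergent_if_step_le_decrease: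
  fixes x :: "nat \<Rightarrow> 'a::banach" and \<Psi> :: "nat \<Rightarrow> real"
  assumes step: "\<And>k. K \<le> k \<Longrightarrow> c * norm (x (Suc k) - x k) \<le> \<Psi> k - \<Psi> (Suc k)"
    and "0 < c" and bdd: "bdd_below (range \<Psi>)"
  shows "convergent x"
proof -
  have *: "c * norm (x n - x m) \<le> \<Psi> m - \<Psi> n" if "K \<le> m" "m \<le> n" for m n
    using \<open>m \<le> n\<close>
  proof (induction n rule: dec_induct)
    case (step n)
    have "c * norm (x (Suc n) - x m) \<le> c * (norm (x (Suc n) - x n) + norm (x n - x m))"
      using \<open>0 < c\<close> norm_triangle_ineq[of "x (Suc n) - x n" "x n - x m"]
      by (intro mult_left_mono) auto
    then show ?case
      using step.IH assms(1)[of n] step.hyps \<open>K \<le> m\<close> by (simp add: algebra_simps)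
  qed simp
  have "decseq (\<lambda>k. \<Psi> (k + K))"
  proof (rule decseq_SucI)
    fix k
    have "0 \<le> c * norm (x (Suc (k + K)) - x (k + K))"
      using \<open>0 < c\<close> by simp
    then show "\<Psi> (Suc k + K) \<le> \<Psi> (k + K)"
      using step[of "k + K"] by simp
  qed
  moreover obtain b where "\<And>k. b \<le> \<Psi> k"
    using bdd by (auto simp: bdd_below_def)
  ultimately obtain L where "(\<lambda>k. \<Psi> (k + K)) \<longlonglongrightarrow> L"
    using decseq_convergent[of "\<lambda>k. \<Psi> (k + K)" b] by blast
  then have "Cauchy \<Psi>"
    using LIMSEQ_offset[of \<Psi> K L] LIMSEQ_imp_Cauchy by blast
  have "Cauchy x"
    unfolding Cauchy_altdef2
  proof (intro allI impI)
    fix e :: real assume "0 < e"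
    then have "0 < c * e"
      using \<open>0 < c\<close> by simp
    then obtain N where N: "\<And>m n. N \<le> m \<Longrightarrow> N \<le> n \<Longrightarrow> dist (\<Psi> m) (\<Psi> n) < c * e"
      using \<open>Cauchy \<Psi>\<close> unfolding Cauchy_def by blast
    have "dist (x n) (x (max N K)) < e" if "max N K \<le> n" for n
    proof -
      have "c * norm (x n - x (max N K)) < c * e"
        using *[of "max N K" n] N[of "max N K" n] that by (simp add: dist_real_def)
      then show ?thesis
        using \<open>0 < c\<close> by (simp add: dist_norm)
    qed
    then show "\<exists>N. \<forall>n\<ge>N. dist (x n) (x N) < e"
      by blast
  qed
  then show ?thesis
    by (rule Cauchy_convergent)
qed

theorem theorem4p5:
  fixes f :: "real^'n \<Rightarrow> real" and g :: "real^'n \<Rightarrow> real^'n" and \<phi> :: "real^'n \<Rightarrow> real"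
    and B :: "nat \<Rightarrow> real^'n^'n" and d x :: "nat \<Rightarrow> real^'n" and \<mu> :: "nat \<Rightarrow> real"
    and p_min c1 c2 \<sigma>1 \<sigma>2 :: real
  assumes "\<And>y. GDERIV f y :> g y" and "continuous_on UNIV g"
    and "convex_on UNIV \<phi>"
    and "0 < \<mu> 0"
    and "0 < p_min" and "p_min < 1/2"
    and "0 < c1" and "c1 < 1/2"
    and "c1 < c2" and "c2 < 1"
    and "0 < \<sigma>1" and "\<sigma>1 < 1" and "1 < \<sigma>2"
    and "rpqn_sequence f g \<phi> p_min c1 c2 \<sigma>1 \<sigma>2 B d x \<mu>"
    and "\<And>k. \<not> stationary_point g \<phi> (x k)"
    and "bounded (range B)" and "\<And>k. transpose (B k) = B k"
    and "bdd_below (range (\<lambda>y. f y + \<phi> y))"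
  shows "liminf (\<lambda>k. ereal (norm (residual g \<phi> (x k)))) = 0"
proof (rule ccontr)
  let ?r = "\<lambda>k. norm (residual g \<phi> (x k))"
  assume "liminf (\<lambda>k. ereal (?r k)) \<noteq> 0"
  moreover have "0 \<le> liminf (\<lambda>k. ereal (?r k))"
    by (rule Liminf_bounded) simp
  ultimately have "0 < liminf (\<lambda>k. ereal (?r k))"
    by simp
  then obtain \<epsilon>' where "0 < \<epsilon>'" "\<epsilon>' < liminf (\<lambda>k. ereal (?r k))"
    using dense by blast
  then obtain \<epsilon> where "0 < \<epsilon>" and \<epsilon>: "ereal \<epsilon> < liminf (\<lambda>k. ereal (?r k))"
    by (cases \<epsilon>') auto
  obtain K where K: "\<And>k. K \<le> k \<Longrightarrow> \<epsilon> \<le> ?r k"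
    using less_LiminfD[OF \<epsilon>] by (auto simp: eventually_sequentially intro: less_imp_le)
  obtain M where "0 < M" and M: "\<And>k v. norm (B k *v v) \<le> M * norm v"
    using bounded_matrices_operator_bound[OF assms(16)] by blast
  have step: "rpqn_step f g \<phi> p_min c1 c2 \<sigma>1 \<sigma>2 (B k) (d k) (x k) (\<mu> k) (x (Suc k)) (\<mu> (Suc k))"
    for k
    using assms(14) by (simp add: rpqn_sequence_def)
  have \<mu>_pos: "0 < \<mu> k" for k
  proof (induction k)
    case (Suc k)
    show ?case
      using step[of k] less_imp_le[OF \<open>0 < p_min\<close>]
    proof (cases rule: rpqn_step_cases)
      case rejected
      then show ?thesis using Suc \<open>1 < \<sigma>2\<close> by simp
    next
      case accepted
      then show ?thesis using Suc \<open>0 < \<sigma>1\<close> by auto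
    qed
  qed (rule \<open>0 < \<mu> 0\<close>)

  have "convergent x"
  proof (rule convergent_if_step_le_decrease)
    show "c1 * p_min * \<epsilon> * norm (x (Suc k) - x k)
        \<le> (f (x k) + \<phi> (x k)) - (f (x (Suc k)) + \<phi> (x (Suc k)))" if "K \<le> k" for k
      using rpqn_step_descent[OF step[of k] _ _ K[OF that]] \<open>0 < p_min\<close> \<open>0 < c1\<close> by simp
    show "0 < c1 * p_min * \<epsilon>"
      using \<open>0 < p_min\<close> \<open>0 < c1\<close> \<open>0 < \<epsilon>\<close> by simp
    show "bdd_below (range (\<lambda>k. f (x k) + \<phi> (x k)))"
      using assms(18) by (rule bdd_below_mono) auto
  qed
  then obtain z where z: "x \<longlonglongrightarrow> z"
    by (auto simp: convergent_def)
  have C: "compact (closure (range x))"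
    using convergent_imp_bounded[OF z] by (simp add: compact_closure)
  have x_in: "x k \<in> closure (range x)" for k
    using closure_subset[of "range x"] by blast
  have "c1 < 1"
    using \<open>c1 < 1/2\<close> by simp
  obtain T where T_step: "\<And>B d y \<mu> y' \<mu>'. rpqn_step f g \<phi> p_min c1 c2 \<sigma>1 \<sigma>2 B d y \<mu> y' \<mu>' \<Longrightarrow>
      y \<in> closure (range x) \<Longrightarrow> \<epsilon> \<le> norm (residual g \<phi> y) \<Longrightarrow> transpose B = B \<Longrightarrow>
      (\<And>v. norm (B *v v) \<le> M * norm v) \<Longrightarrow> T \<le> \<mu> \<Longrightarrow> \<mu>' \<le> \<mu>"
    by (rule rpqn_step_parameter_threshold[where ?c2.0 = c2 and ?\<sigma>2.0 = \<sigma>2, OF assms(1-3) C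
          \<open>0 < \<epsilon>\<close> \<open>0 < M\<close> assms(5,6) \<open>c1 < 1\<close> less_imp_le[OF \<open>\<sigma>1 < 1\<close>]]) blast
  have T: "\<mu> (Suc k) \<le> \<mu> k" if "K \<le> k" "T \<le> \<mu> k" for k
    using T_step[OF step[of k] x_in K[OF that(1)] assms(17) M that(2)] .
  \<comment> \<open>Below \<open>T\<close> one update multiplies the parameter by at most \<open>\<sigma>2\<close>; above \<open>T\<close> it cannot
    increase.\<close>
  define U where "U = max (\<mu> K) (\<sigma>2 * max T 0)"
  have \<mu>_le: "\<mu> k \<le> U" if "K \<le> k" for k
    using that
  proof (induction k rule: dec_induct)
    case (step k)
    show ?case
    proof (cases "T \<le> \<mu> k")
      case True
      then show ?thesis
        using T step by fastforce
    next
      case False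
      show ?thesis
        using \<open>rpqn_step f g \<phi> p_min c1 c2 \<sigma>1 \<sigma>2 (B k) (d k) (x k) (\<mu> k) (x (Suc k)) (\<mu> (Suc k))\<close>
          less_imp_le[OF \<open>0 < p_min\<close>]
      proof (cases rule: rpqn_step_cases)
        case rejected
        have "\<sigma>2 * \<mu> k \<le> \<sigma>2 * max T 0"
          using False \<open>1 < \<sigma>2\<close> by (intro mult_left_mono) auto
        then show ?thesis
          by (simp add: rejected U_def)
      next
        case accepted
        have "\<sigma>1 * \<mu> k \<le> \<mu> k"
          using \<mu>_pos[of k] \<open>\<sigma>1 < 1\<close> by simp
        then show ?thesis
          using accepted(5) step.IH by auto
      qed
    qed
  qed (simp add: U_def)

  have "0 < U"
    using \<mu>_pos[of K] \<mu>_le[of K] by simp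
  then have "0 < \<epsilon> / (2 + M + U)"
    using \<open>0 < \<epsilon>\<close> \<open>0 < M\<close> by simp
  then obtain N where N: "\<And>m n. N \<le> m \<Longrightarrow> N \<le> n \<Longrightarrow> dist (x m) (x n) < \<epsilon> / (2 + M + U)"
    using LIMSEQ_imp_Cauchy[OF z] unfolding Cauchy_def by blast
  \<comment> \<open>An accepted step is longer than what the Cauchy property permits.\<close>
  have rej: "\<mu> (Suc k) = \<sigma>2 * \<mu> k" if "max N K \<le> k" for k
    using step[of k] less_imp_le[OF \<open>0 < p_min\<close>]
  proof (cases rule: rpqn_step_cases)
    case accepted
    have "\<epsilon> \<le> (2 + M + \<mu> k) * norm (d k)"
      using K[of k] residual_le_step[OF assms(3,17) M less_imp_le[OF \<mu>_pos] accepted(1)] that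
      by simp
    also have "\<dots> \<le> (2 + M + U) * norm (d k)"
      using \<mu>_le[of k] that by (intro mult_right_mono) auto
    also have "norm (d k) = dist (x (Suc k)) (x k)"
      by (simp add: accepted(2) dist_norm)
    also have "(2 + M + U) * dist (x (Suc k)) (x k) < \<epsilon>"
      using N[of "Suc k" k] that \<open>0 < M\<close> \<open>0 < U\<close> by (simp add: field_simps)
    finally show ?thesis
      by simp
  qed
  have geo: "\<mu> (max N K + j) = \<sigma>2 ^ j * \<mu> (max N K)" for j
  proof (induction j)
    case (Suc j)
    then show ?case using rej[of "max N K + j"] by simp
  qed simp
  obtain j where "U / \<mu> (max N K) < \<sigma>2 ^ j"
    using real_arch_pow[OF \<open>1 < \<sigma>2\<close>] by blast
  then have "U < \<mu> (max N K + j)"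
    using \<mu>_pos[of "max N K"] by (subst geo) (simp add: field_simps)
  then show False
    using \<mu>_le[of "max N K + j"] by (simp add: trans_le_add1)
qed

end
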